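(* Let $p\in\{1,2,\dots\}\cup\{+\infty\}$, let $\boldsymbol\beta=(1,2,1,2,\dots)$ (that is, $\beta_k=1$ for even $k$ and $\beta_k=2$ for odd $k$, $0\le k\le p+1$), and let $\boldsymbol\delta=(\delta_k)_{k=0,\dots,p}$ be a real sequence with $\delta_1=-1$. Then $\boldsymbol\alpha=(\alpha_k)_{k=0,\dots,p}$ is $(\boldsymbol\beta,p)$-related to $\boldsymbol\delta$, with associated rational functions $\hat\alpha_k$, if and only if $\hat\alpha_0=0$, $\alpha_k=\mathfrak e(\hat\alpha_k)$ for all $k$, $\hat\alpha_1=\hat\delta_0$, $\hat\alpha_{2q}=0$ for $2\le 2q\le p$, and for all $q\ge1$ with $2q+1\le p$ $$\hat\alpha_{2q+1}=\sum_{\substack{m=2\\ m\text{ even}}}^{2q}\hat\delta_m\sum_{k_1+\dots+k_m=2q}\hat\alpha_{k_1}\cdots\hat\alpha_{k_m}+\sum_{\substack{m=3\\ m\text{ odd}}}^{2q+1}\hat\delta_m\sum_{k_1+\dots+k_m=2q+1}\hat\alpha_{k_1}\cdots\hat\alpha_{k_m}.$$ In particular, there exists one and only one sequence $\boldsymbol\alpha$ which is $(\boldsymbol\beta,p)$-related to $\boldsymbol\delta$.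
   Context: Definition ($(\boldsymbol\beta,p)$-related sequence). Given integers $\boldsymbol\beta=(\beta_0,\dots,\beta_{p+1})$, put $\beta_\star:=\max_{2\le m\le p+1}\beta_m$ and $\gamma_m:=p+1+\min(\beta_m-\beta_\star,0)$ (with $\gamma_m=+\infty$ if $p=+\infty$). Let $\hat\delta_0,\hat\delta_2,\dots,\hat\delta_p$ be independent indeterminates ("dummy" versions of the numbers $\delta_k$), and let $\hat\delta_1:=-1$ be the constant, since $\delta_1$ is here fixed equal to $-1$. Let $\mathbb K$ be the field of rational functions over $\mathbb R$ in these indeterminates, $z$ a further indeterminate, and $\mathfrak e$ the evaluation map sending $\hat\delta_k$ to $\delta_k$ (defined on rational functions whose denominator does not vanish at $\boldsymbol\delta$). A real sequence $\boldsymbol\alpha=(\alpha_k)_{k=0,\dots,p}$ is $(\boldsymbol\beta,p)$-related to $\boldsymbol\delta$ if there exist $\hat\alpha_k\in\mathbb K$, $k=0,\dots,p$, with $\hat\alpha_0=0$, $\alpha_k=\mathfrak e(\hat\alpha_k)$, and $$\hat\delta_0z^{-\beta_0}+\sum_{m=1}^p\hat\delta_m\sum_{k_1+\dots+k_m<\gamma_m}\hat\alpha_{k_1}\cdots\hat\alpha_{k_m}z^{k_1+\dots+k_m-\beta_m}=0,$$ meaning that the coefficient in $\mathbb K$ of each power of $z$ vanishes. Sums run over multi-indices of integers $k_i\ge1$ (indices $k_i=0$ contribute nothing since $\hat\alpha_0=0$). *)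

theory Defs
  imports
    Complex_Main
    "HOL-Library.Poly_Mapping"
    "HOL-Library.Extended_Nat"
    "HOL-Library.Extended_Real"
    "HOL-Library.FuncSet"
    "HOL-Computational_Algebra.Fraction_Field"
begin

text \<open>
  Multivariate real polynomials in indeterminates indexed by \<^typ>\<open>nat\<close>: a monomial is a finitely
  supported exponent function, a polynomial a finitely supported map from monomials to coefficients.
\<close>

type_synonym mpoly_real = "(nat \<Rightarrow>\<^sub>0 nat) \<Rightarrow>\<^sub>0 real"
type_synonym ratfun = "mpoly_real fract"

definition monom_eval :: "(nat \<Rightarrow> real) \<Rightarrow> (nat \<Rightarrow>\<^sub>0 nat) \<Rightarrow> real" where
  "monom_eval \<delta> m = (\<Prod>i\<in>Poly_Mapping.keys m. \<delta> i ^ Poly_Mapping.lookup m i)"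

definition poly_eval :: "(nat \<Rightarrow> real) \<Rightarrow> mpoly_real \<Rightarrow> real" where
  "poly_eval \<delta> f = (\<Sum>m\<in>Poly_Mapping.keys f. Poly_Mapping.lookup f m * monom_eval \<delta> m)"

text \<open>There is no indeterminate with index 1: \<open>\<delta>hat 1\<close> is the constant \<open>-1\<close>.\<close>

definition indets :: "enat \<Rightarrow> nat set" where
  "indets p = {k. enat k \<le> p \<and> k \<noteq> 1}"

definition polys :: "enat \<Rightarrow> mpoly_real set" where
  "polys p = {f. \<forall>m\<in>Poly_Mapping.keys f. Poly_Mapping.keys m \<subseteq> indets p}"

text \<open>The field \<open>\<bbbK>\<close>, as a subfield of the rational functions in all indeterminates.\<close>

definition ratfuns :: "enat \<Rightarrow> ratfun set" where
  "ratfuns p = {Fract a b | a b. a \<in> polys p \<and> b \<in> polys p \<and> b \<noteq> 0}"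

definition \<delta>hat :: "nat \<Rightarrow> ratfun" where
  "\<delta>hat k = (if k = 1 then - 1 else Fract (Poly_Mapping.single (Poly_Mapping.single k 1) 1) 1)"

text \<open>
  The evaluation map is partial: \<open>eval_dom p \<delta>\<close> is its domain, and \<open>eval_map p \<delta>\<close> is meaningful
  only there. Independence of the chosen fraction is lemma \<open>eval_map_Fract\<close>.
\<close>

definition eval_dom :: "enat \<Rightarrow> (nat \<Rightarrow> real) \<Rightarrow> ratfun set" where
  "eval_dom p \<delta> = {Fract a b | a b. a \<in> polys p \<and> b \<in> polys p \<and> poly_eval \<delta> b \<noteq> 0}"

definition eval_map :: "enat \<Rightarrow> (nat \<Rightarrow> real) \<Rightarrow> ratfun \<Rightarrow> real" where
  "eval_map p \<delta> r = (THE x. \<exists>a b. a \<in> polys p \<and> b \<in> polys p \<and> poly_eval \<delta> b \<noteq> 0 \<and>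
     r = Fract a b \<and> x = poly_eval \<delta> a / poly_eval \<delta> b)"

text \<open>
  For \<open>p = \<infinity>\<close> the maximum in \<open>\<beta>star\<close> may range over an infinite set, but \<open>\<gamma>\<close> is then \<open>\<infinity>\<close>
  whatever the value of \<open>\<beta>star\<close>.
\<close>

definition \<beta>star :: "(nat \<Rightarrow> int) \<Rightarrow> enat \<Rightarrow> int" where
  "\<beta>star \<beta> p = Max (\<beta> ` {m. 2 \<le> m \<and> enat m \<le> p + 1})"

definition \<gamma> :: "(nat \<Rightarrow> int) \<Rightarrow> enat \<Rightarrow> nat \<Rightarrow> ereal" where
  "\<gamma> \<beta> p m = ereal_of_enat p + 1 + ereal (of_int (min (\<beta> m - \<beta>star \<beta> p) 0))"

definition multi_indices :: "nat \<Rightarrow> nat list set" where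
  "multi_indices m = {ks. length ks = m \<and> (\<forall>k\<in>set ks. 1 \<le> k)}"

definition index_prod :: "(nat \<Rightarrow> ratfun) \<Rightarrow> nat list \<Rightarrow> ratfun" where
  "index_prod \<alpha>hat ks = (\<Prod>k\<leftarrow>ks. \<alpha>hat k)"

text \<open>
  \<open>contributions \<beta> p j\<close> lists the pairs of \<open>m\<close> and a multi-index whose term is a multiple of
  \<open>z\<^sup>j\<close>, so \<open>eqn_coeff \<beta> p \<alpha>hat j\<close> is the coefficient of \<open>z\<^sup>j\<close> in the defining equation.
  Since \<open>m \<le> k\<^sub>1 + \<dots> + k\<^sub>m = j + \<beta>\<^sub>m\<close>, the set is finite if \<open>p < \<infinity>\<close> or \<open>\<beta>\<close> is bounded above.
  If it is infinite, the sum over it is 0 by convention.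
\<close>

definition contributions :: "(nat \<Rightarrow> int) \<Rightarrow> enat \<Rightarrow> int \<Rightarrow> (nat \<times> nat list) set" where
  "contributions \<beta> p j = {(m, ks). 1 \<le> m \<and> enat m \<le> p \<and> ks \<in> multi_indices m \<and>
     ereal (real (sum_list ks)) < \<gamma> \<beta> p m \<and> int (sum_list ks) - \<beta> m = j}"

definition eqn_coeff :: "(nat \<Rightarrow> int) \<Rightarrow> enat \<Rightarrow> (nat \<Rightarrow> ratfun) \<Rightarrow> int \<Rightarrow> ratfun" where
  "eqn_coeff \<beta> p \<alpha>hat j = (if j = - \<beta> 0 then \<delta>hat 0 else 0) +
     (\<Sum>(m, ks)\<in>contributions \<beta> p j. \<delta>hat m * index_prod \<alpha>hat ks)"

text \<open>
  Sequences indexed by \<open>0, \<dots>, p\<close> are functions on \<^typ>\<open>nat\<close>, of which only the values at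
  indices \<open>\<le> p\<close> are used.
\<close>

definition related_via ::
  "(nat \<Rightarrow> int) \<Rightarrow> enat \<Rightarrow> (nat \<Rightarrow> real) \<Rightarrow> (nat \<Rightarrow> real) \<Rightarrow> (nat \<Rightarrow> ratfun) \<Rightarrow> bool" where
  "related_via \<beta> p \<delta> \<alpha> \<alpha>hat \<longleftrightarrow>
     (\<forall>k. enat k \<le> p \<longrightarrow> \<alpha>hat k \<in> ratfuns p) \<and>
     \<alpha>hat 0 = 0 \<and>
     (\<forall>k. enat k \<le> p \<longrightarrow> \<alpha>hat k \<in> eval_dom p \<delta> \<and> \<alpha> k = eval_map p \<delta> (\<alpha>hat k)) \<and>
     (\<forall>j. eqn_coeff \<beta> p \<alpha>hat j = 0)"

definition related :: "(nat \<Rightarrow> int) \<Rightarrow> enat \<Rightarrow> (nat \<Rightarrow> real) \<Rightarrow> (nat \<Rightarrow> real) \<Rightarrow> bool" where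
  "related \<beta> p \<delta> \<alpha> \<longleftrightarrow> (\<exists>\<alpha>hat. related_via \<beta> p \<delta> \<alpha> \<alpha>hat)"

definition \<beta>12 :: "nat \<Rightarrow> int" where
  "\<beta>12 k = (if even k then 1 else 2)"


lemma poly_eval_superset:
  assumes "finite A" "Poly_Mapping.keys f \<subseteq> A"
  shows "poly_eval \<delta> f = (\<Sum>m\<in>A. Poly_Mapping.lookup f m * monom_eval \<delta> m)"
  unfolding poly_eval_def using assms
  by (intro sum.mono_neutral_left) (auto simp: in_keys_iff)

lemma monom_eval_superset:
  assumes "finite A" "Poly_Mapping.keys m \<subseteq> A"
  shows "monom_eval \<delta> m = (\<Prod>i\<in>A. \<delta> i ^ Poly_Mapping.lookup m i)"
  unfolding monom_eval_def using assms
  by (intro prod.mono_neutral_left) (auto simp: in_keys_iff)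

lemma monom_eval_add: "monom_eval \<delta> (m + n) = monom_eval \<delta> m * monom_eval \<delta> n"
proof -
  let ?A = "Poly_Mapping.keys m \<union> Poly_Mapping.keys n"
  have "Poly_Mapping.keys (m + n) \<subseteq> ?A" by (rule keys_add)
  then show ?thesis
    by (simp add: monom_eval_superset[of ?A] lookup_add power_add prod.distrib)
qed

lemma poly_eval_zero [simp]: "poly_eval \<delta> 0 = 0"
  by (simp add: poly_eval_def)

lemma poly_eval_add: "poly_eval \<delta> (f + g) = poly_eval \<delta> f + poly_eval \<delta> g"
proof -
  let ?A = "Poly_Mapping.keys f \<union> Poly_Mapping.keys g"
  have "Poly_Mapping.keys (f + g) \<subseteq> ?A" by (rule keys_add)
  then show ?thesis
    by (simp add: poly_eval_superset[of ?A] lookup_add sum.distrib algebra_simps)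
qed

lemma poly_eval_sum: "poly_eval \<delta> (sum f A) = (\<Sum>x\<in>A. poly_eval \<delta> (f x))"
  by (induction A rule: infinite_finite_induct) (simp_all add: poly_eval_add)

lemma poly_eval_single: "poly_eval \<delta> (Poly_Mapping.single m c) = c * monom_eval \<delta> m"
  by (simp add: poly_eval_def)

lemma poly_as_sum: "(f :: mpoly_real) = (\<Sum>m\<in>Poly_Mapping.keys f. Poly_Mapping.single m (Poly_Mapping.lookup f m))"
proof (rule poly_mapping_eqI)
  fix k
  have "(\<Sum>m\<in>Poly_Mapping.keys f. Poly_Mapping.lookup (Poly_Mapping.single m (Poly_Mapping.lookup f m)) k) =
        (\<Sum>m\<in>Poly_Mapping.keys f. if k = m then Poly_Mapping.lookup f m else 0)"
    by (rule sum.cong) (auto simp: lookup_single when_def)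
  also have "\<dots> = Poly_Mapping.lookup f k"
    by (simp add: sum.delta in_keys_iff)
  finally show "Poly_Mapping.lookup f k = Poly_Mapping.lookup (\<Sum>m\<in>Poly_Mapping.keys f. Poly_Mapping.single m (Poly_Mapping.lookup f m)) k"
    by (simp add: lookup_sum)
qed

lemma poly_eval_mult: "poly_eval \<delta> (f * g) = poly_eval \<delta> f * poly_eval \<delta> g"
proof -
  have "f * g = (\<Sum>m\<in>Poly_Mapping.keys f. \<Sum>n\<in>Poly_Mapping.keys g. Poly_Mapping.single (m + n) (Poly_Mapping.lookup f m * Poly_Mapping.lookup g n))"
    by (subst (1) poly_as_sum[of f], subst (1) poly_as_sum[of g])
       (simp add: sum_product mult_single)
  then have "poly_eval \<delta> (f * g) = (\<Sum>m\<in>Poly_Mapping.keys f. \<Sum>n\<in>Poly_Mapping.keys g.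
      (Poly_Mapping.lookup f m * monom_eval \<delta> m) * (Poly_Mapping.lookup g n * monom_eval \<delta> n))"
    by (simp add: poly_eval_sum poly_eval_single monom_eval_add algebra_simps)
  then show ?thesis
    by (simp add: sum_product poly_eval_def)
qed

lemma eval_map_Fract:
  assumes "a \<in> polys p" "b \<in> polys p" "poly_eval \<delta> b \<noteq> 0"
  shows "eval_map p \<delta> (Fract a b) = poly_eval \<delta> a / poly_eval \<delta> b"
  unfolding eval_map_def
proof (rule the_equality)
  show "\<exists>a' b'. a' \<in> polys p \<and> b' \<in> polys p \<and> poly_eval \<delta> b' \<noteq> 0 \<and> Fract a b = Fract a' b' \<and>
      poly_eval \<delta> a / poly_eval \<delta> b = poly_eval \<delta> a' / poly_eval \<delta> b'"
    using assms by blast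
next
  fix x
  assume "\<exists>a' b'. a' \<in> polys p \<and> b' \<in> polys p \<and> poly_eval \<delta> b' \<noteq> 0 \<and> Fract a b = Fract a' b' \<and>
      x = poly_eval \<delta> a' / poly_eval \<delta> b'"
  then obtain a' b' where *: "poly_eval \<delta> b' \<noteq> 0" "Fract a b = Fract a' b'"
      "x = poly_eval \<delta> a' / poly_eval \<delta> b'" by blast
  from * assms have "b \<noteq> 0" "b' \<noteq> 0" by auto
  with * have "a * b' = a' * b" by (simp add: eq_fract)
  then have "poly_eval \<delta> a * poly_eval \<delta> b' = poly_eval \<delta> a' * poly_eval \<delta> b"
    by (metis poly_eval_mult)
  with * assms show "x = poly_eval \<delta> a / poly_eval \<delta> b"
    by (simp add: frac_eq_eq)
qed

end

theory Submission
  imports Defs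
begin

text \<open>
  For \<open>\<beta> = (1, 2, 1, 2, \<dots>)\<close> the truncation \<open>\<gamma>\<close> is such that the coefficient of \<open>z\<^sup>n\<^sup>-\<^sup>2\<close> in the
  defining equation is empty unless \<open>1 \<le> n \<le> p\<close>, and otherwise contains the whole homogeneous
  parts of weight \<open>n\<close> (\<open>m\<close> odd) and \<open>n - 1\<close> (\<open>m\<close> even). As \<open>\<delta>hat 1 = -1\<close>, its vanishing expresses
  \<open>\<alpha>hat n\<close> through the \<open>\<alpha>hat k\<close> with \<open>k < n\<close>. For even \<open>n\<close>, parity forces an even index into
  every multi-index that occurs, so by induction \<open>\<alpha>hat n = 0\<close>. The recursion only adds and
  multiplies, so its solution consists of polynomials, which can be evaluated everywhere.
\<close>

text \<open>This is the coefficient of \<open>z^s\<close> in the \<open>m\<close>-th power of the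
  formal series with coefficients \<open>a k\<close>, \<open>k \<ge> 1\<close>.\<close>

definition coeff_sum :: "(nat \<Rightarrow> ratfun) \<Rightarrow> nat \<Rightarrow> nat \<Rightarrow> ratfun" where
  "coeff_sum a m s = (\<Sum>ks | ks \<in> multi_indices m \<and> sum_list ks = s. index_prod a ks)"

text \<open>One formula covers \<open>n = 1\<close>, even \<open>n\<close> and odd \<open>n\<close>,
  so that inductions need no case distinction; the three cases of the theorem are split off
  afterwards.\<close>

definition rec_rhs :: "(nat \<Rightarrow> ratfun) \<Rightarrow> nat \<Rightarrow> ratfun" where
  "rec_rhs a n = (if n = 1 then \<delta>hat 0 else 0) +
     (\<Sum>m | 2 \<le> m \<and> m \<le> n - 1 \<and> even m. \<delta>hat m * coeff_sum a m (n - 1)) +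
     (\<Sum>m | 3 \<le> m \<and> m \<le> n \<and> odd m. \<delta>hat m * coeff_sum a m n)"

subsection \<open>Multi-indices\<close>

lemma finite_multi_indices_sum: "finite {ks. ks \<in> multi_indices m \<and> sum_list ks = s}"
proof (rule finite_subset)
  show "{ks. ks \<in> multi_indices m \<and> sum_list ks = s} \<subseteq> {ks. set ks \<subseteq> {..s} \<and> length ks = m}"
    by (auto simp: multi_indices_def member_le_sum_list)
qed (simp add: finite_lists_length_eq)

lemma length_le_sum_list:
  fixes ks :: "nat list"
  assumes "\<forall>k\<in>set ks. 1 \<le> k"
  shows "length ks \<le> sum_list ks"
  using assms by (induction ks) auto

lemma multi_index_length_le: "ks \<in> multi_indices m \<Longrightarrow> m \<le> sum_list ks"
  using length_le_sum_list by (auto simp: multi_indices_def)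

text \<open>The other \<open>m - 1\<close> entries are at least 1 each. The additive form avoids
  truncated subtraction.\<close>

lemma multi_index_member_le:
  assumes "ks \<in> multi_indices m" "k \<in> set ks"
  shows "k + m \<le> sum_list ks + 1"
proof -
  from assms(2) obtain xs ys where ks: "ks = xs @ k # ys"
    by (meson split_list)
  with assms(1) have "length xs \<le> sum_list xs" "length ys \<le> sum_list ys"
    "m = length xs + length ys + 1"
    by (auto simp: multi_indices_def intro!: length_le_sum_list)
  with ks show ?thesis by simp
qed

lemma even_sum_list_odd_entries:
  fixes ks :: "nat list"
  assumes "\<forall>k\<in>set ks. odd k"
  shows "even (sum_list ks) \<longleftrightarrow> even (length ks)"
  using assms by (induction ks) auto

lemma coeff_sum_eq_0_if_less: "s < m \<Longrightarrow> coeff_sum a m s = 0"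
  unfolding coeff_sum_def by (rule sum.neutral) (auto dest: multi_index_length_le)

lemma coeff_sum_cong:
  assumes "\<And>k. 1 \<le> k \<Longrightarrow> k + m \<le> s + 1 \<Longrightarrow> a k = b k"
  shows "coeff_sum a m s = coeff_sum b m s"
  unfolding coeff_sum_def index_prod_def
proof (intro sum.cong refl arg_cong[where f = prod_list] map_cong)
  fix ks k
  assume "ks \<in> {ks. ks \<in> multi_indices m \<and> sum_list ks = s}" "k \<in> set ks"
  then show "a k = b k"
    using assms[of k] multi_index_member_le[of ks m k] by (auto simp: multi_indices_def)
qed

text \<open>If all \<open>m\<close> entries were odd, their sum \<open>s\<close> would have the
  parity of \<open>m\<close>. So every product has a factor with even index, and this factor is 0.
  Only indices up to \<open>s + 1 - m\<close> can occur, which is all that an induction can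
  provide.\<close>

lemma coeff_sum_eq_0_if_parity:
  assumes "odd (m + s)" and "\<And>k. 1 \<le> k \<Longrightarrow> k + m \<le> s + 1 \<Longrightarrow> even k \<Longrightarrow> a k = 0"
  shows "coeff_sum a m s = 0"
  unfolding coeff_sum_def
proof (rule sum.neutral, rule ballI)
  fix ks
  assume "ks \<in> {ks. ks \<in> multi_indices m \<and> sum_list ks = s}"
  then have ks: "ks \<in> multi_indices m" "sum_list ks = s" by auto
  have "\<not> (\<forall>k\<in>set ks. odd k)"
    using even_sum_list_odd_entries[of ks] ks assms(1) by (auto simp: multi_indices_def)
  then obtain k where "k \<in> set ks" "even k" by blast
  moreover from this ks have "a k = 0"
    using multi_index_member_le[of ks m k] by (intro assms(2)) (auto simp: multi_indices_def)
  ultimately show "index_prod a ks = 0"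
    by (force simp: index_prod_def prod_list_zero_iff)
qed

subsection \<open>The recursion\<close>

text \<open>Both sums only reach indices \<open>k \<le> n - 2\<close>: weight \<open>n - 1\<close>
  comes with \<open>m \<ge> 2\<close>, and weight \<open>n\<close> with \<open>m \<ge> 3\<close>.
  Existence and uniqueness of the solution both rest on this.\<close>

lemma rec_rhs_cong:
  assumes "\<And>k. 1 \<le> k \<Longrightarrow> k < n \<Longrightarrow> a k = b k"
  shows "rec_rhs a n = rec_rhs b n"
  unfolding rec_rhs_def
  by (intro arg_cong2[where f = "(+)"] sum.cong refl arg_cong2[where f = "(*)"] coeff_sum_cong)
     (auto intro: assms)

text \<open>For even \<open>n\<close>, the weight has the opposite parity to \<open>m\<close> in
  both sums: even \<open>m\<close> goes with \<open>n - 1\<close>, odd \<open>m\<close> with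
  \<open>n\<close>.\<close>

lemma rec_rhs_even:
  assumes "even n" and "\<And>k. 1 \<le> k \<Longrightarrow> k < n \<Longrightarrow> even k \<Longrightarrow> a k = 0"
  shows "rec_rhs a n = 0"
proof -
  have "coeff_sum a m (n - 1) = 0" if "2 \<le> m" "m \<le> n - 1" "even m" for m
    using that assms(1) by (intro coeff_sum_eq_0_if_parity assms(2)) auto
  moreover have "coeff_sum a m n = 0" if "3 \<le> m" "odd m" for m
    using that assms(1) by (intro coeff_sum_eq_0_if_parity assms(2)) auto
  ultimately show ?thesis
    using assms(1) by (auto simp: rec_rhs_def intro!: sum.neutral)
qed

lemma rec_rhs_1: "rec_rhs a 1 = \<delta>hat 0"
proof -
  have "{m::nat. 2 \<le> m \<and> m \<le> 1 - 1 \<and> even m} = {}" "{m::nat. 3 \<le> m \<and> m \<le> 1 \<and> odd m} = {}"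
    by auto
  then show ?thesis
    unfolding rec_rhs_def by (simp only: sum.empty) simp
qed

lemma rec_rhs_odd:
  assumes "1 \<le> q"
  shows "rec_rhs a (2 * q + 1) =
    (\<Sum>m | 2 \<le> m \<and> m \<le> 2 * q \<and> even m.
       \<delta>hat m * (\<Sum>ks | ks \<in> multi_indices m \<and> sum_list ks = 2 * q. index_prod a ks)) +
    (\<Sum>m | 3 \<le> m \<and> m \<le> 2 * q + 1 \<and> odd m.
       \<delta>hat m * (\<Sum>ks | ks \<in> multi_indices m \<and> sum_list ks = 2 * q + 1. index_prod a ks))"
  using assms by (simp add: rec_rhs_def coeff_sum_def)

lemma solves_recursion_iff:
  fixes p :: enat
  assumes "1 \<le> p"
  shows "(\<forall>n. 1 \<le> n \<and> enat n \<le> p \<longrightarrow> a n = rec_rhs a n) \<longleftrightarrow>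
    a 1 = \<delta>hat 0 \<and>
    (\<forall>q. 2 \<le> 2 * q \<and> enat (2 * q) \<le> p \<longrightarrow> a (2 * q) = 0) \<and>
    (\<forall>q. 1 \<le> q \<and> enat (2 * q + 1) \<le> p \<longrightarrow> a (2 * q + 1) = rec_rhs a (2 * q + 1))"
    (is "?L \<longleftrightarrow> ?R")
proof
  assume L: ?L
  have "a n = 0" if "1 \<le> n" "enat n \<le> p" "even n" for n
    using that
  proof (induction n rule: less_induct)
    case (less n)
    have "a k = 0" if "1 \<le> k" "k < n" "even k" for k
      using that less.prems(2) by (intro less.IH) (auto intro: order_trans[of _ "enat n"])
    then have "rec_rhs a n = 0"
      using less.prems(3) by (intro rec_rhs_even)
    with L less.prems show ?case by simp
  qed
  moreover have "a 1 = \<delta>hat 0"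
    using L assms rec_rhs_1[of a] by (simp add: one_enat_def)
  ultimately show ?R using L by auto
next
  assume R: ?R
  show ?L
  proof (intro allI impI)
    fix n assume n: "1 \<le> n \<and> enat n \<le> p"
    have small: "enat k \<le> p" if "k < n" for k
      using that n by (auto intro: order_trans[of _ "enat n"])
    show "a n = rec_rhs a n"
    proof (cases "even n")
      case True
      have ev: "a k = 0" if "1 \<le> k" "enat k \<le> p" "even k" for k
        using R that by (auto elim!: evenE)
      from True n ev small show ?thesis
        by (simp add: rec_rhs_even)
    next
      case False
      then obtain q where q: "n = 2 * q + 1" by (auto elim: oddE)
      show ?thesis
      proof (cases "q = 0")
        case True
        with q R rec_rhs_1[of a] show ?thesis by simp
      next
        case False
        with q R n show ?thesis by simp
      qed
    qed
  qed
qed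

subsection \<open>The coefficients of the defining equation\<close>

text \<open>For finite \<open>p \<ge> 2\<close> the maximum \<open>\<beta>star\<close> is 2, so the
  bound is \<open>p + 1\<close> for odd \<open>m\<close> and \<open>p\<close> for even
  \<open>m\<close>. For infinite \<open>p\<close> both sides are true.\<close>

lemma less_\<gamma>_\<beta>12_iff:
  assumes "1 \<le> m" "enat m \<le> p"
  shows "ereal (real s) < \<gamma> \<beta>12 p m \<longleftrightarrow> enat (if odd m then s else s + 1) \<le> p"
proof (cases p)
  case infinity
  then show ?thesis by (simp add: \<gamma>_def)
next
  case (enat P)
  show ?thesis
  proof (cases "P = 1")
    case True
    \<comment> \<open>With \<open>p = 1\<close> the maximum runs over the index 2 alone and equals
      1; only \<open>m = 1\<close> occurs, and its bound is still \<open>p + 1\<close>.\<close>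
    then have "{m. 2 \<le> m \<and> enat m \<le> p + 1} = {2}"
      using enat by (auto simp: one_enat_def)
    moreover have "m = 1" using True enat assms by simp
    ultimately show ?thesis
      using enat True by (auto simp: \<gamma>_def \<beta>star_def \<beta>12_def one_ereal_def)
  next
    case False
    with assms enat have "2 \<le> P" by simp
    \<comment> \<open>The value 2 is attained at index 3, which is in range because
      \<open>3 \<le> P + 1\<close>.\<close>
    then have "\<beta>star \<beta>12 p = 2"
      unfolding \<beta>star_def using enat
      by (intro Max_eqI) (auto simp: \<beta>12_def one_enat_def image_iff intro!: exI[of _ 3])
    then show ?thesis
      using enat by (auto simp: \<gamma>_def \<beta>12_def one_ereal_def)
  qed
qed

text \<open>The exponent \<open>n - 2\<close> forces the weight \<open>n - 2 + \<beta>12 m\<close>,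
  that is, \<open>n\<close> for odd \<open>m\<close> and \<open>n - 1\<close> for even
  \<open>m\<close>. Since \<open>n \<le> p\<close>, the truncation removes none of these
  terms.\<close>

lemma contributions_\<beta>12:
  assumes "1 \<le> n" "enat n \<le> p"
  shows "contributions \<beta>12 p (int n - 2) =
    (SIGMA m:{1..n}. {ks. ks \<in> multi_indices m \<and> sum_list ks = (if odd m then n else n - 1)})"
  (is "?L = ?R")
proof (rule subset_antisym; rule subrelI)
  fix m ks assume "(m, ks) \<in> ?L"
  then have "1 \<le> m" "ks \<in> multi_indices m" "int (sum_list ks) - \<beta>12 m = int n - 2"
    by (auto simp: contributions_def)
  with multi_index_length_le[of ks m] show "(m, ks) \<in> ?R"
    by (auto simp: \<beta>12_def split: if_splits)
next
  fix m ks assume *: "(m, ks) \<in> ?R"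
  then have "enat m \<le> p"
    using assms(2) by (auto intro: order_trans[of _ "enat n"])
  with * assms show "(m, ks) \<in> ?L"
    by (auto simp: contributions_def less_\<gamma>_\<beta>12_iff \<beta>12_def)
qed

text \<open>A multi-index of weight \<open>s\<close> sits at exponent \<open>n - 2\<close> with
  \<open>n = s\<close> for odd \<open>m\<close> and \<open>n = s + 1\<close> for even
  \<open>m\<close>; in both cases the truncation condition says precisely
  \<open>n \<le> p\<close>.\<close>

lemma contributions_\<beta>12_empty:
  assumes "\<not> (\<exists>n\<ge>1. enat n \<le> p \<and> j = int n - 2)"
  shows "contributions \<beta>12 p j = {}"
proof (rule equals0I, clarify)
  fix m ks assume "(m, ks) \<in> contributions \<beta>12 p j"
  then have *: "1 \<le> m" "enat m \<le> p" "ks \<in> multi_indices m"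
    "ereal (real (sum_list ks)) < \<gamma> \<beta>12 p m" "j = int (sum_list ks) - \<beta>12 m"
    by (auto simp: contributions_def)
  define n where "n = (if odd m then sum_list ks else sum_list ks + 1)"
  have "1 \<le> n" "enat n \<le> p" "j = int n - 2"
    using * multi_index_length_le[of ks m] less_\<gamma>_\<beta>12_iff[of m p "sum_list ks"]
    by (auto simp: n_def \<beta>12_def)
  with assms show False by blast
qed

lemma coeff_sum_1:
  assumes "1 \<le> n"
  shows "coeff_sum a 1 n = a n"
proof -
  have "{ks. ks \<in> multi_indices 1 \<and> sum_list ks = n} = {[n]}"
    using assms by (auto simp: multi_indices_def length_Suc_conv)
  then show ?thesis by (simp add: coeff_sum_def index_prod_def)
qed

text \<open>The term \<open>m = 1\<close> yields \<open>- a n\<close>, since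
  \<open>\<delta>hat 1\<close> is \<open>- 1\<close>. The isolated term \<open>\<delta>hat 0\<close>
  has exponent \<open>-1\<close>, hence belongs to \<open>n = 1\<close>.\<close>

lemma eqn_coeff_\<beta>12:
  assumes "1 \<le> n" "enat n \<le> p"
  shows "eqn_coeff \<beta>12 p a (int n - 2) = rec_rhs a n - a n"
proof -
  let ?f = "\<lambda>m. \<delta>hat m * coeff_sum a m (if odd m then n else n - 1)"
  let ?E = "{m. 2 \<le> m \<and> m \<le> n - 1 \<and> even m}" and ?O = "{m. 3 \<le> m \<and> m \<le> n \<and> odd m}"
  have fin: "finite ?E" "finite ?O"
    by (rule finite_subset[of _ "{..n}"]; auto)+
  have "(\<Sum>(m, ks)\<in>contributions \<beta>12 p (int n - 2). \<delta>hat m * index_prod a ks) =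
    (\<Sum>m\<in>{1..n}. ?f m)"
    unfolding contributions_\<beta>12[OF assms]
    by (subst sum.Sigma[symmetric])
       (auto simp: finite_multi_indices_sum coeff_sum_def sum_distrib_left)
  also have "\<dots> = (\<Sum>m\<in>insert 1 (?E \<union> ?O). ?f m)"
  proof (rule sum.mono_neutral_right)
    show "\<forall>m\<in>{1..n} - insert 1 (?E \<union> ?O). ?f m = 0"
    proof
      fix m assume m: "m \<in> {1..n} - insert 1 (?E \<union> ?O)"
      have "even m"
      proof (rule ccontr)
        assume "odd m"
        with m have "3 \<le> m" by (auto elim!: oddE)
        with m \<open>odd m\<close> show False by auto
      qed
      with m have "n - 1 < m" by auto
      with \<open>even m\<close> show "?f m = 0" by (simp add: coeff_sum_eq_0_if_less)
    qed
  qed (use assms in auto)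
  also have "\<dots> = ?f 1 + ((\<Sum>m\<in>?E. ?f m) + (\<Sum>m\<in>?O. ?f m))"
  proof (subst sum.insert)
    show "?f 1 + (\<Sum>m\<in>?E \<union> ?O. ?f m) = ?f 1 + ((\<Sum>m\<in>?E. ?f m) + (\<Sum>m\<in>?O. ?f m))"
      using fin by (subst sum.union_disjoint) auto
  qed (use fin in auto)
  also have "(\<Sum>m\<in>?E. ?f m) = (\<Sum>m\<in>?E. \<delta>hat m * coeff_sum a m (n - 1))"
    by (rule sum.cong) auto
  also have "(\<Sum>m\<in>?O. ?f m) = (\<Sum>m\<in>?O. \<delta>hat m * coeff_sum a m n)"
    by (rule sum.cong) auto
  also have "?f 1 = - a n"
    using coeff_sum_1[OF assms(1), of a] by (simp add: \<delta>hat_def)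
  finally have "(\<Sum>(m, ks)\<in>contributions \<beta>12 p (int n - 2). \<delta>hat m * index_prod a ks) =
    - a n + ((\<Sum>m\<in>?E. \<delta>hat m * coeff_sum a m (n - 1)) + (\<Sum>m\<in>?O. \<delta>hat m * coeff_sum a m n))" .
  moreover have "int n - 2 = - \<beta>12 0 \<longleftrightarrow> n = 1"
    by (auto simp: \<beta>12_def)
  ultimately show ?thesis
    unfolding eqn_coeff_def rec_rhs_def by (simp only:) (simp add: algebra_simps)
qed

lemma eqn_coeff_\<beta>12_eq_0_iff:
  assumes "1 \<le> p"
  shows "(\<forall>j. eqn_coeff \<beta>12 p a j = 0) \<longleftrightarrow> (\<forall>n. 1 \<le> n \<and> enat n \<le> p \<longrightarrow> a n = rec_rhs a n)"
proof (intro iffI allI impI)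
  fix n assume "\<forall>j. eqn_coeff \<beta>12 p a j = 0" "1 \<le> n \<and> enat n \<le> p"
  then show "a n = rec_rhs a n"
    using eqn_coeff_\<beta>12[of n p a] by simp
next
  fix j assume rec: "\<forall>n. 1 \<le> n \<and> enat n \<le> p \<longrightarrow> a n = rec_rhs a n"
  show "eqn_coeff \<beta>12 p a j = 0"
  proof (cases "\<exists>n\<ge>1. enat n \<le> p \<and> j = int n - 2")
    case True
    with rec show ?thesis using eqn_coeff_\<beta>12 by fastforce
  next
    case False
    \<comment> \<open>The exponent \<open>-1\<close> is \<open>n - 2\<close> for
      \<open>n = 1\<close>, which is in range as \<open>1 \<le> p\<close>; so
      \<open>\<delta>hat 0\<close> does not appear at \<open>j\<close> either.\<close>
    then have "j \<noteq> - \<beta>12 0"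
      using assms by (auto simp: \<beta>12_def one_enat_def dest: spec[of _ 1])
    with False show ?thesis
      by (simp add: eqn_coeff_def contributions_\<beta>12_empty)
  qed
qed

lemma related_via_\<beta>12_iff:
  assumes "1 \<le> p"
  shows "related_via \<beta>12 p \<delta> \<alpha> \<alpha>hat \<longleftrightarrow>
     (\<forall>k. enat k \<le> p \<longrightarrow> \<alpha>hat k \<in> ratfuns p) \<and>
     \<alpha>hat 0 = 0 \<and>
     (\<forall>k. enat k \<le> p \<longrightarrow> \<alpha>hat k \<in> eval_dom p \<delta> \<and> \<alpha> k = eval_map p \<delta> (\<alpha>hat k)) \<and>
     (\<forall>n. 1 \<le> n \<and> enat n \<le> p \<longrightarrow> \<alpha>hat n = rec_rhs \<alpha>hat n)"
  unfolding related_via_def eqn_coeff_\<beta>12_eq_0_iff[OF assms] ..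

subsection \<open>Polynomial solutions\<close>

lemma polys_add: "f \<in> polys p \<Longrightarrow> g \<in> polys p \<Longrightarrow> f + g \<in> polys p"
  using keys_add[of f g] by (auto simp: polys_def)

lemma polys_mult:
  assumes "f \<in> polys p" "g \<in> polys p"
  shows "f * g \<in> polys p"
  unfolding polys_def
proof (intro CollectI ballI)
  fix m assume "m \<in> Poly_Mapping.keys (f * g)"
  then obtain x y where "m = x + y" "x \<in> Poly_Mapping.keys f" "y \<in> Poly_Mapping.keys g"
    using keys_mult[of f g] by blast
  with assms show "Poly_Mapping.keys m \<subseteq> indets p"
    using keys_add[of x y] unfolding polys_def by blast
qed

lemma one_in_polys: "1 \<in> polys p"
  by (simp add: polys_def)

text \<open>The copy of the polynomial ring inside the field. It is closed under the operations of
  the recursion, and the denominator 1 does not vanish at any \<open>\<delta>\<close>.\<close>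

definition poly_fracts :: "enat \<Rightarrow> ratfun set" where
  "poly_fracts p = (\<lambda>f. Fract f 1) ` polys p"

lemma poly_fracts_0: "0 \<in> poly_fracts p"
  by (auto simp: poly_fracts_def polys_def Zero_fract_def)

lemma poly_fracts_1: "1 \<in> poly_fracts p"
  by (auto simp: poly_fracts_def one_in_polys One_fract_def)

lemma poly_fracts_add: "x \<in> poly_fracts p \<Longrightarrow> y \<in> poly_fracts p \<Longrightarrow> x + y \<in> poly_fracts p"
  by (auto simp: poly_fracts_def polys_add)

lemma poly_fracts_mult: "x \<in> poly_fracts p \<Longrightarrow> y \<in> poly_fracts p \<Longrightarrow> x * y \<in> poly_fracts p"
  by (auto simp: poly_fracts_def polys_mult)

lemma poly_fracts_sum: "(\<And>x. x \<in> A \<Longrightarrow> f x \<in> poly_fracts p) \<Longrightarrow> sum f A \<in> poly_fracts p"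
  by (induction A rule: infinite_finite_induct) (auto simp: poly_fracts_0 poly_fracts_add)

lemma poly_fracts_index_prod:
  "(\<And>k. k \<in> set ks \<Longrightarrow> a k \<in> poly_fracts p) \<Longrightarrow> index_prod a ks \<in> poly_fracts p"
  unfolding index_prod_def by (induction ks) (auto simp: poly_fracts_1 poly_fracts_mult)

lemma \<delta>hat_in_poly_fracts:
  assumes "enat k \<le> p"
  shows "\<delta>hat k \<in> poly_fracts p"
proof (cases "k = 1")
  case True
  have "- 1 \<in> polys p" by (simp add: polys_def)
  with True show ?thesis
    by (auto simp: \<delta>hat_def poly_fracts_def One_fract_def)
next
  case False
  with assms show ?thesis
    by (auto simp: \<delta>hat_def poly_fracts_def polys_def indets_def)
qed

lemma rec_rhs_in_poly_fracts:
  assumes "\<And>k. a k \<in> poly_fracts p" "enat n \<le> p"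
  shows "rec_rhs a n \<in> poly_fracts p"
proof -
  have "enat m \<le> p" if "m \<le> n" for m
    using that assms(2) by (auto intro: order_trans[of _ "enat n"])
  then show ?thesis
    unfolding rec_rhs_def coeff_sum_def
    by (auto intro!: poly_fracts_add poly_fracts_sum poly_fracts_mult poly_fracts_index_prod
        \<delta>hat_in_poly_fracts assms(1) poly_fracts_0)
qed

lemma poly_fracts_subset_eval_dom: "poly_fracts p \<subseteq> eval_dom p \<delta>"
proof -
  have "poly_eval \<delta> 1 = 1"
    by (simp add: poly_eval_single monom_eval_def flip: single_one)
  then have "poly_eval \<delta> 1 \<noteq> 0" by simp
  then show ?thesis
    unfolding poly_fracts_def eval_dom_def using one_in_polys by blast
qed

lemma eval_dom_subset_ratfuns: "eval_dom p \<delta> \<subseteq> ratfuns p"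
  by (auto simp: eval_dom_def ratfuns_def) (metis poly_eval_zero)

text \<open>The guard \<open>k < n\<close> makes termination visible although \<open>rec_rhs\<close>
  takes the whole sequence as an argument; \<open>rec_rhs_cong\<close> removes it again. The
  sequence depends neither on \<open>p\<close> nor on \<open>\<delta>\<close>.\<close>

function rec_sol :: "nat \<Rightarrow> ratfun" where
  "rec_sol n = (if n = 0 then 0 else rec_rhs (\<lambda>k. if k < n then rec_sol k else 0) n)"
  by auto
termination
  by (relation "measure id") auto

declare rec_sol.simps [simp del]

lemma rec_sol_0: "rec_sol 0 = 0"
  by (simp add: rec_sol.simps)

lemma rec_sol_eq: "1 \<le> n \<Longrightarrow> rec_sol n = rec_rhs rec_sol n"
  by (subst rec_sol.simps) (auto intro!: rec_rhs_cong)

lemma rec_sol_in_poly_fracts: "enat n \<le> p \<Longrightarrow> rec_sol n \<in> poly_fracts p"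
proof (induction n rule: less_induct)
  case (less n)
  have "rec_sol k \<in> poly_fracts p" if "k < n" for k
    using that less.prems by (intro less.IH) (auto intro: order_trans[of _ "enat n"])
  then show ?case
    using less.prems
    \<comment> \<open>In the guarded sequence the values at \<open>k \<ge> n\<close> are 0, so all
      its values are polynomials, as \<open>rec_rhs_in_poly_fracts\<close> demands.\<close>
    by (subst rec_sol.simps) (auto intro!: rec_rhs_in_poly_fracts simp: poly_fracts_0)
qed

lemma recursion_solution_unique:
  assumes "a 0 = 0" "\<forall>n. 1 \<le> n \<and> enat n \<le> p \<longrightarrow> a n = rec_rhs a n" "enat n \<le> p"
  shows "a n = rec_sol n"
  using assms(3)
proof (induction n rule: less_induct)
  case (less n)
  show ?case
  proof (cases "n = 0")
    case True
    with assms(1) show ?thesis by (simp add: rec_sol_0)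
  next
    case False
    have "a k = rec_sol k" if "k < n" for k
      using that less.prems by (intro less.IH) (auto intro: order_trans[of _ "enat n"])
    then have "rec_rhs a n = rec_rhs rec_sol n"
      by (intro rec_rhs_cong)
    with False assms(2) less.prems show ?thesis by (simp add: rec_sol_eq)
  qed
qed

section \<open>Existence and uniqueness of the related sequence\<close>

lemma related_\<beta>12_iff:
  assumes "1 \<le> p"
  shows "related \<beta>12 p \<delta> \<alpha> \<longleftrightarrow> (\<forall>k. enat k \<le> p \<longrightarrow> \<alpha> k = eval_map p \<delta> (rec_sol k))"
proof
  assume "related \<beta>12 p \<delta> \<alpha>"
  then obtain a where a: "related_via \<beta>12 p \<delta> \<alpha> a"
    by (auto simp: related_def)
  \<comment> \<open>Uniqueness already holds for the rational functions, hence also for their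
    values.\<close>
  then have "a k = rec_sol k" if "enat k \<le> p" for k
    using that unfolding related_via_\<beta>12_iff[OF assms]
    by (intro recursion_solution_unique) auto
  with a show "\<forall>k. enat k \<le> p \<longrightarrow> \<alpha> k = eval_map p \<delta> (rec_sol k)"
    by (simp add: related_via_def)
next
  \<comment> \<open>Polynomials can be evaluated at every \<open>\<delta>\<close>, so the formal
    solution does give a real sequence.\<close>
  have dom: "rec_sol k \<in> eval_dom p \<delta>" if "enat k \<le> p" for k
    using rec_sol_in_poly_fracts[OF that] poly_fracts_subset_eval_dom by blast
  assume "\<forall>k. enat k \<le> p \<longrightarrow> \<alpha> k = eval_map p \<delta> (rec_sol k)"
  then have "related_via \<beta>12 p \<delta> \<alpha> rec_sol"
    unfolding related_via_\<beta>12_iff[OF assms]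
    using dom eval_dom_subset_ratfuns[of p \<delta>]
    by (intro conjI allI impI) (auto simp: rec_sol_0 intro: rec_sol_eq)
  then show "related \<beta>12 p \<delta> \<alpha>"
    by (auto simp: related_def)
qed

theorem lemma5:
  fixes p :: enat and \<delta> :: "nat \<Rightarrow> real"
  assumes "1 \<le> p" and "\<delta> 1 = - 1"
  shows "(\<forall>\<alpha> \<alpha>hat. related_via \<beta>12 p \<delta> \<alpha> \<alpha>hat \<longleftrightarrow>
           (\<forall>k. enat k \<le> p \<longrightarrow> \<alpha>hat k \<in> ratfuns p) \<and>
           \<alpha>hat 0 = 0 \<and>
           (\<forall>k. enat k \<le> p \<longrightarrow> \<alpha>hat k \<in> eval_dom p \<delta> \<and> \<alpha> k = eval_map p \<delta> (\<alpha>hat k)) \<and>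
           \<alpha>hat 1 = \<delta>hat 0 \<and>
           (\<forall>q. 2 \<le> 2 * q \<and> enat (2 * q) \<le> p \<longrightarrow> \<alpha>hat (2 * q) = 0) \<and>
           (\<forall>q. 1 \<le> q \<and> enat (2 * q + 1) \<le> p \<longrightarrow>
              \<alpha>hat (2 * q + 1) =
                (\<Sum>m | 2 \<le> m \<and> m \<le> 2 * q \<and> even m.
                   \<delta>hat m * (\<Sum>ks | ks \<in> multi_indices m \<and> sum_list ks = 2 * q.
                     index_prod \<alpha>hat ks)) +
                (\<Sum>m | 3 \<le> m \<and> m \<le> 2 * q + 1 \<and> odd m.
                   \<delta>hat m * (\<Sum>ks | ks \<in> multi_indices m \<and> sum_list ks = 2 * q + 1.
                     index_prod \<alpha>hat ks))))
         \<and> (\<exists>!\<alpha>. \<alpha> \<in> extensional {k. enat k \<le> p} \<and> related \<beta>12 p \<delta> \<alpha>)"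
proof (intro conjI allI)
  fix \<alpha> :: "nat \<Rightarrow> real" and \<alpha>hat :: "nat \<Rightarrow> ratfun"
  have odd_eqns: "(\<forall>q. 1 \<le> q \<and> enat (2 * q + 1) \<le> p \<longrightarrow>
      \<alpha>hat (2 * q + 1) = rec_rhs \<alpha>hat (2 * q + 1)) \<longleftrightarrow>
    (\<forall>q. 1 \<le> q \<and> enat (2 * q + 1) \<le> p \<longrightarrow> \<alpha>hat (2 * q + 1) =
      (\<Sum>m | 2 \<le> m \<and> m \<le> 2 * q \<and> even m.
         \<delta>hat m * (\<Sum>ks | ks \<in> multi_indices m \<and> sum_list ks = 2 * q. index_prod \<alpha>hat ks)) +
      (\<Sum>m | 3 \<le> m \<and> m \<le> 2 * q + 1 \<and> odd m.
         \<delta>hat m * (\<Sum>ks | ks \<in> multi_indices m \<and> sum_list ks = 2 * q + 1. index_prod \<alpha>hat ks)))"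
    \<comment> \<open>The congruence rule makes the premise \<open>1 \<le> q\<close> available for
      rewriting with \<open>rec_rhs_odd\<close>.\<close>
    by (simp only: rec_rhs_odd cong: imp_cong)
  show "related_via \<beta>12 p \<delta> \<alpha> \<alpha>hat \<longleftrightarrow>
           (\<forall>k. enat k \<le> p \<longrightarrow> \<alpha>hat k \<in> ratfuns p) \<and>
           \<alpha>hat 0 = 0 \<and>
           (\<forall>k. enat k \<le> p \<longrightarrow> \<alpha>hat k \<in> eval_dom p \<delta> \<and> \<alpha> k = eval_map p \<delta> (\<alpha>hat k)) \<and>
           \<alpha>hat 1 = \<delta>hat 0 \<and>
           (\<forall>q. 2 \<le> 2 * q \<and> enat (2 * q) \<le> p \<longrightarrow> \<alpha>hat (2 * q) = 0) \<and>
           (\<forall>q. 1 \<le> q \<and> enat (2 * q + 1) \<le> p \<longrightarrow>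
              \<alpha>hat (2 * q + 1) =
                (\<Sum>m | 2 \<le> m \<and> m \<le> 2 * q \<and> even m.
                   \<delta>hat m * (\<Sum>ks | ks \<in> multi_indices m \<and> sum_list ks = 2 * q.
                     index_prod \<alpha>hat ks)) +
                (\<Sum>m | 3 \<le> m \<and> m \<le> 2 * q + 1 \<and> odd m.
                   \<delta>hat m * (\<Sum>ks | ks \<in> multi_indices m \<and> sum_list ks = 2 * q + 1.
                     index_prod \<alpha>hat ks)))"
    unfolding related_via_\<beta>12_iff[OF assms(1)] solves_recursion_iff[OF assms(1)] odd_eqns ..
next
  \<comment> \<open>Relatedness says nothing about values beyond \<open>p\<close>; restricting to
    the indices up to \<open>p\<close> selects the one extensional representative.\<close>
  let ?\<alpha> = "restrict (\<lambda>k. eval_map p \<delta> (rec_sol k)) {k. enat k \<le> p}"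
  show "\<exists>!\<alpha>. \<alpha> \<in> extensional {k. enat k \<le> p} \<and> related \<beta>12 p \<delta> \<alpha>"
  proof (rule ex1I[of _ ?\<alpha>])
    show "?\<alpha> \<in> extensional {k. enat k \<le> p} \<and> related \<beta>12 p \<delta> ?\<alpha>"
      by (simp add: related_\<beta>12_iff[OF assms(1)])
  next
    fix \<alpha> assume "\<alpha> \<in> extensional {k. enat k \<le> p} \<and> related \<beta>12 p \<delta> \<alpha>"
    then show "\<alpha> = ?\<alpha>"
      by (intro extensionalityI[of _ "{k. enat k \<le> p}"]) (auto simp: related_\<beta>12_iff[OF assms(1)])
  qed
qed

end
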